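(* Let $\mathbf y=(y_1,\dots,y_n)$ be i.i.d. observations, let $M_0,M_1$ be two parametric models with non-informative priors $\pi_0^N,\pi_1^N$, and let $\mathbf y(1),\dots,\mathbf y(L)$ be all the minimal training samples contained in $\mathbf y$. The empirical Intrinsic Bayes Factor upper and lower bounds are obtained from the Empirical SP prior; that is, the Empirical SP Bayes factor satisfies $$B^{SP*}_{10}=B^N_{10}(\mathbf y)\,\sup_{\ell=1,\dots,L}B^N_{01}(\mathbf y(\ell))=\overline{B}^{I*}_{10}(\mathbf y),$$ and correspondingly, with $B^{SP*}_{01}=1/B^{SP*}_{10}$, $$B^{SP*}_{01}=B^N_{01}(\mathbf y)\,\inf_{\ell=1,\dots,L}B^N_{10}(\mathbf y(\ell))=\underline{B}^{I*}_{01}(\mathbf y).$$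
   Context: Model $M_k$ ($k=0,1$) has density $f_k(\cdot\mid\theta_k)$ and a (usually improper) prior $\pi_k^N(\theta_k)$. For a sample $\mathbf z$ of i.i.d. observations, $f_k(\mathbf z\mid\theta_k)$ is the product of the individual densities, $m_k(\mathbf z)=\int f_k(\mathbf z\mid\theta_k)\pi_k^N(\theta_k)\,d\theta_k$, and $B_{ij}^N(\mathbf z)=m_i(\mathbf z)/m_j(\mathbf z)$. The marginals $m_0(\mathbf y),m_1(\mathbf y)$ of the whole sample are assumed to lie in $(0,\infty)$. A training sample (sub-collection of the data) $\mathbf y(\ell)$ is proper if $0<m_k(\mathbf y(\ell))<\infty$ for $k=0,1$, and minimal if it is proper and no proper subset of it is proper. Minimal training samples all have the same size $s=\max\{\dim\theta_0,\dim\theta_1\}$, and there are $L=\binom{n}{s}$ of them, obtained from all the index subsets of size $s$; their set is the set of empirical minimal training samples. The empirical Intrinsic Bayes Factor bounds are $$\overline{B}^{I*}_{10}(\mathbf y)=B^N_{10}(\mathbf y)\sup_{\ell=1,\dots,L}B^N_{01}(\mathbf y(\ell)),\qquad \underline{B}^{I*}_{01}(\mathbf y)=B^N_{01}(\mathbf y)\inf_{\ell=1,\dots,L}B^N_{10}(\mathbf y(\ell)).$$ Let $\mathbf y^*_E(\ell)$ be a minimal training sample from the data at which $\ell\mapsto m_0(\mathbf y(\ell))/m_1(\mathbf y(\ell))$ attains its supremum over $\ell=1,\dots,L$. The Empirical SP prior is, for $k=0,1$, $$\pi_k^{SP*}(\theta_k)=\frac{f_k(\mathbf y^*_E(\ell)\mid\theta_k)\,\pi_k^N(\theta_k)}{m_k(\mathbf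 y^*_E(\ell))}.$$ With $\mathbf y(-\ell)=\mathbf y\setminus\mathbf y^*_E(\ell)$ the remaining data, the Empirical SP Bayes factor is $$B^{SP*}_{10}=\frac{\int f_1(\mathbf y(-\ell)\mid\theta_1)\,\pi_1^{SP*}(\theta_1)\,d\theta_1}{\int f_0(\mathbf y(-\ell)\mid\theta_0)\,\pi_0^{SP*}(\theta_0)\,d\theta_0}.$$ *)

theory Defs
  imports "HOL-Analysis.Analysis"
begin

text \<open>
  The dimension of a parameter is a natural number (and not a type), so that the two models can have
  different dimensions and a simple hypothesis, without any parameter, is covered by dimension 0.
  A parameter of dimension \<open>d\<close> is an extensional function on \<open>{..<d}\<close>, and \<open>d\<theta>\<close> is the
  product Lebesgue measure; for \<open>d = 0\<close> it is the point mass at the only parameter value.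
\<close>

record 'x bayes_model =
  param_dim :: nat
  param_space :: "(nat \<Rightarrow> real) set"
  dens :: "(nat \<Rightarrow> real) \<Rightarrow> 'x \<Rightarrow> real"
  prior :: "(nat \<Rightarrow> real) \<Rightarrow> real"

definition param_lebesgue :: "('x, 'r) bayes_model_scheme \<Rightarrow> (nat \<Rightarrow> real) measure" where
  "param_lebesgue M = (\<Pi>\<^sub>M i\<in>{..<param_dim M}. lborel)"

definition param_measure :: "('x, 'r) bayes_model_scheme \<Rightarrow> (nat \<Rightarrow> real) measure" where
  "param_measure M = restrict_space (param_lebesgue M) (param_space M)"

text \<open>
  The measure \<open>\<nu>\<close> dominates the distributions of a single observation (under both models of a
  comparison). The integral of the prior is left unconstrained, so the prior may be improper.
\<close>

definition parametric_model :: "'x measure \<Rightarrow> ('x, 'r) bayes_model_scheme \<Rightarrow> bool" where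
  "parametric_model \<nu> M \<longleftrightarrow>
     param_space M \<in> sets (param_lebesgue M) \<and>
     (\<lambda>(\<theta>, x). dens M \<theta> x) \<in> borel_measurable (param_measure M \<Otimes>\<^sub>M \<nu>) \<and>
     (\<forall>\<theta>\<in>param_space M. (\<forall>x\<in>space \<nu>. 0 \<le> dens M \<theta> x) \<and>
        (\<integral>\<^sup>+x. ennreal (dens M \<theta> x) \<partial>\<nu>) = 1) \<and>
     prior M \<in> borel_measurable (param_measure M) \<and>
     (\<forall>\<theta>\<in>param_space M. 0 \<le> prior M \<theta>)"

text \<open>
  A sample is given by the data \<open>y\<close> and the set \<open>I\<close> of the indices of the observations in it, so
  that observations with equal values remain distinct.
\<close>

definition likelihood ::
  "('x, 'r) bayes_model_scheme \<Rightarrow> (nat \<Rightarrow> 'x) \<Rightarrow> nat set \<Rightarrow> (nat \<Rightarrow> real) \<Rightarrow> real" where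
  "likelihood M y I \<theta> = (\<Prod>i\<in>I. dens M \<theta> (y i))"

definition marginal_wrt ::
  "('x, 'r) bayes_model_scheme \<Rightarrow> ((nat \<Rightarrow> real) \<Rightarrow> real) \<Rightarrow> (nat \<Rightarrow> 'x) \<Rightarrow> nat set \<Rightarrow> ennreal"
where
  "marginal_wrt M p y I = (\<integral>\<^sup>+\<theta>. ennreal (likelihood M y I \<theta> * p \<theta>) \<partial>param_measure M)"

definition marginal ::
  "('x, 'r) bayes_model_scheme \<Rightarrow> (nat \<Rightarrow> 'x) \<Rightarrow> nat set \<Rightarrow> ennreal" where
  "marginal M y I = marginal_wrt M (prior M) y I"

definition bayes_factor ::
  "('x, 'r) bayes_model_scheme \<Rightarrow> ('x, 's) bayes_model_scheme \<Rightarrow> (nat \<Rightarrow> 'x) \<Rightarrow> nat set \<Rightarrow> ennreal"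
where
  "bayes_factor M M' y I = marginal M y I / marginal M' y I"

definition proper_sample ::
  "('x, 'r) bayes_model_scheme \<Rightarrow> ('x, 's) bayes_model_scheme \<Rightarrow> (nat \<Rightarrow> 'x) \<Rightarrow> nat set \<Rightarrow> bool"
where
  "proper_sample M0 M1 y I \<longleftrightarrow>
     0 < marginal M0 y I \<and> marginal M0 y I < \<infinity> \<and>
     0 < marginal M1 y I \<and> marginal M1 y I < \<infinity>"

definition minimal_training_samples ::
  "('x, 'r) bayes_model_scheme \<Rightarrow> ('x, 's) bayes_model_scheme \<Rightarrow> nat \<Rightarrow> (nat \<Rightarrow> 'x) \<Rightarrow> nat set set"
where
  "minimal_training_samples M0 M1 n y =
     {I. I \<subseteq> {1..n} \<and> proper_sample M0 M1 y I \<and> (\<forall>I'. I' \<subset> I \<longrightarrow> \<not> proper_sample M0 M1 y I')}"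

text \<open>
  In the bounds, \<open>T 1, \<dots>, T L\<close> are the index sets of the minimal training samples.
\<close>

definition empirical_IBF_upper ::
  "('x, 'r) bayes_model_scheme \<Rightarrow> ('x, 's) bayes_model_scheme \<Rightarrow> nat \<Rightarrow> (nat \<Rightarrow> 'x) \<Rightarrow>
     (nat \<Rightarrow> nat set) \<Rightarrow> nat \<Rightarrow> ennreal" where
  "empirical_IBF_upper M0 M1 n y T L =
     bayes_factor M1 M0 y {1..n} * (SUP l\<in>{1..L}. bayes_factor M0 M1 y (T l))"

definition empirical_IBF_lower ::
  "('x, 'r) bayes_model_scheme \<Rightarrow> ('x, 's) bayes_model_scheme \<Rightarrow> nat \<Rightarrow> (nat \<Rightarrow> 'x) \<Rightarrow>
     (nat \<Rightarrow> nat set) \<Rightarrow> nat \<Rightarrow> ennreal" where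
  "empirical_IBF_lower M0 M1 n y T L =
     bayes_factor M0 M1 y {1..n} * (INF l\<in>{1..L}. bayes_factor M1 M0 y (T l))"

text \<open>
  Below, \<open>E\<close> is the index set of the training sample maximising the ratio of the marginals.
\<close>

definition SP_prior ::
  "('x, 'r) bayes_model_scheme \<Rightarrow> (nat \<Rightarrow> 'x) \<Rightarrow> nat set \<Rightarrow> (nat \<Rightarrow> real) \<Rightarrow> real" where
  "SP_prior M y E \<theta> = likelihood M y E \<theta> * prior M \<theta> / enn2real (marginal M y E)"

definition SP_bayes_factor ::
  "('x, 'r) bayes_model_scheme \<Rightarrow> ('x, 's) bayes_model_scheme \<Rightarrow> nat \<Rightarrow> (nat \<Rightarrow> 'x) \<Rightarrow> nat set \<Rightarrow>
     ennreal" where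
  "SP_bayes_factor M M' n y E =
     marginal_wrt M (SP_prior M y E) y ({1..n} - E) /
     marginal_wrt M' (SP_prior M' y E) y ({1..n} - E)"

end

theory Submission
  imports Defs
begin

text \<open>
  The SP prior is the posterior given the training sample \<open>E\<close>, so updating it with the remaining
  data gives the quotient \<open>m(y) / m(y(E))\<close> of marginals under each model. Hence the SP Bayes factor
  is the full-sample Bayes factor corrected by \<open>m\<^sub>0(y(E)) / m\<^sub>1(y(E))\<close>, which is the supremum by the
  choice of \<open>E\<close>; taking reciprocals of finite positive numbers turns it into the infimum.
\<close>

lemma measurable_dens:
  assumes "parametric_model \<nu> M" and "x \<in> space \<nu>"
  shows "(\<lambda>\<theta>. dens M \<theta> x) \<in> borel_measurable (param_measure M)"
proof -
  have "(\<lambda>(\<theta>, x). dens M \<theta> x) \<in> borel_measurable (param_measure M \<Otimes>\<^sub>M \<nu>)"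
    using assms(1) by (simp add: parametric_model_def)
  from measurable_compose[OF measurable_Pair2'[OF assms(2)] this]
  show ?thesis by simp
qed

lemma measurable_likelihood:
  assumes "parametric_model \<nu> M" and "\<And>i. i \<in> I \<Longrightarrow> y i \<in> space \<nu>"
  shows "likelihood M y I \<in> borel_measurable (param_measure M)"
  unfolding likelihood_def[abs_def]
  by (intro borel_measurable_prod measurable_dens[OF assms(1)] assms(2))

text \<open>Given \<open>\<theta>\<close> the observations are independent, so the likelihoods of
  \<open>E\<close> and \<open>J - E\<close> multiply to that of \<open>J\<close>. Normalising by the
  marginal of \<open>E\<close> contributes a constant, which leaves the integral.\<close>

lemma marginal_wrt_SP_prior:
  assumes M: "parametric_model \<nu> M"
    and J: "finite J" "\<And>i. i \<in> J \<Longrightarrow> y i \<in> space \<nu>"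
    and E: "E \<subseteq> J" "0 < marginal M y E" "marginal M y E < \<infinity>"
  shows "marginal_wrt M (SP_prior M y E) y (J - E) = marginal M y J / marginal M y E"
proof -
  \<comment> \<open>Finiteness makes \<open>enn2real\<close> in \<open>SP_prior\<close> return the
    true marginal and not its default value 0 at infinity; positivity rules out a zero
    denominator.\<close>
  obtain m where m: "marginal M y E = ennreal m" "0 < m"
    using E by (cases "marginal M y E") (auto simp: ennreal_less_zero_iff)
  have split: "likelihood M y J \<theta> = likelihood M y (J - E) \<theta> * likelihood M y E \<theta>" for \<theta>
    unfolding likelihood_def by (rule prod.subset_diff[OF E(1) J(1)])
  \<comment> \<open>\<open>ennreal\<close> splits over the product on the right because the constant
    \<open>inverse m\<close> is nonnegative; this is the form in which
    \<open>nn_integral_multc\<close> extracts it.\<close>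
  have "ennreal (likelihood M y (J - E) \<theta> * SP_prior M y E \<theta>) =
      ennreal (likelihood M y J \<theta> * prior M \<theta>) * ennreal (inverse m)" for \<theta>
  proof -
    have "likelihood M y (J - E) \<theta> * SP_prior M y E \<theta> =
        likelihood M y J \<theta> * prior M \<theta> * inverse m"
      using m by (simp add: SP_prior_def split divide_inverse)
    then show ?thesis using m by (simp add: ennreal_mult'')
  qed
  moreover have "prior M \<in> borel_measurable (param_measure M)"
    using M by (simp add: parametric_model_def)
  ultimately show ?thesis
    using measurable_likelihood[OF M J(2)] m
    by (simp add: marginal_wrt_def marginal_def[of M y J] nn_integral_multc
        divide_ennreal_def inverse_ennreal)
qed

text \<open>With \<open>a\<close>, \<open>c\<close> the full-sample marginals of the two models and
  \<open>b\<close>, \<open>d\<close> those of the training sample, this regroups by sample what was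
  grouped by model. The bounds reduce it to real fractions.\<close>

lemma ennreal_divide_divide_divide:
  fixes a b c d :: ennreal
  assumes "a < \<infinity>" "0 < b" "b < \<infinity>" "0 < c" "c < \<infinity>" "0 < d" "d < \<infinity>"
  shows "(a / b) / (c / d) = a / c * (d / b)"
  using assms
  by (cases a; cases b; cases c; cases d)
    (auto simp: divide_ennreal ennreal_mult[symmetric] divide_simps mult_ac)

text \<open>The conventions \<open>inverse 0 = top\<close> and \<open>inverse top = 0\<close> extend
  order reversal to the end points.\<close>

lemma ennreal_inverse_antimono:
  fixes a b :: ennreal
  shows "a \<le> b \<Longrightarrow> inverse b \<le> inverse a"
  by (cases "a = 0"; cases a; cases b) (auto simp: inverse_ennreal top_unique)

lemma ennreal_inverse_divide:
  fixes a b :: ennreal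
  assumes "0 < a" "a < \<infinity>" "0 < b" "b < \<infinity>"
  shows "inverse (a / b) = b / a"
  using assms
  by (cases a; cases b) (auto simp: divide_ennreal inverse_ennreal)

text \<open>Inversion can fail to be multiplicative only at \<open>0 * top\<close>, which the bounds
  exclude.\<close>

lemma ennreal_inverse_mult_divide:
  fixes a b c d :: ennreal
  assumes "0 < a" "a < \<infinity>" "0 < b" "b < \<infinity>" "0 < c" "c < \<infinity>" "0 < d" "d < \<infinity>"
  shows "inverse (a / b * (c / d)) = b / a * (d / c)"
  using ennreal_inverse_mult[of "a / b" "c / d"] assms
  by (simp add: ennreal_inverse_divide ennreal_divide_eq_top_iff less_top[symmetric] zero_less_iff_neq_zero)

theorem theorem4p3p1:
  fixes \<nu> :: "'x measure"
    and M0 M1 :: "'x bayes_model"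
    and n s L l\<^sub>E :: nat
    and y :: "nat \<Rightarrow> 'x"
    and T :: "nat \<Rightarrow> nat set"
  assumes "sigma_finite_measure \<nu>"
    and "parametric_model \<nu> M0" and "parametric_model \<nu> M1"
    and "\<And>i. i \<in> {1..n} \<Longrightarrow> y i \<in> space \<nu>"
    and "0 < marginal M0 y {1..n}" and "marginal M0 y {1..n} < \<infinity>"
    and "0 < marginal M1 y {1..n}" and "marginal M1 y {1..n} < \<infinity>"
    and "s = max (param_dim M0) (param_dim M1)"
    and "minimal_training_samples M0 M1 n y = {I. I \<subseteq> {1..n} \<and> card I = s}"
    and "L = n choose s"
    and "bij_betw T {1..L} (minimal_training_samples M0 M1 n y)"
    and "l\<^sub>E \<in> {1..L}"
    and "marginal M0 y (T l\<^sub>E) / marginal M1 y (T l\<^sub>E) =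
           (SUP l\<in>{1..L}. marginal M0 y (T l) / marginal M1 y (T l))"
  shows "(SP_bayes_factor M1 M0 n y (T l\<^sub>E) =
            bayes_factor M1 M0 y {1..n} * (SUP l\<in>{1..L}. bayes_factor M0 M1 y (T l)) \<and>
          SP_bayes_factor M1 M0 n y (T l\<^sub>E) = empirical_IBF_upper M0 M1 n y T L) \<and>
         (1 / SP_bayes_factor M1 M0 n y (T l\<^sub>E) =
            bayes_factor M0 M1 y {1..n} * (INF l\<in>{1..L}. bayes_factor M1 M0 y (T l)) \<and>
          1 / SP_bayes_factor M1 M0 n y (T l\<^sub>E) = empirical_IBF_lower M0 M1 n y T L)"
proof -
  note M = assms(2,3) and y = assms(4) and full = assms(5-8)
  let ?E = "T l\<^sub>E"
  have T: "T l \<in> minimal_training_samples M0 M1 n y" if "l \<in> {1..L}" for l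
    using assms(12) that by (auto simp: bij_betw_def)
  then have proper: "proper_sample M0 M1 y (T l)" if "l \<in> {1..L}" for l
    using that by (auto simp: minimal_training_samples_def)
  have E: "?E \<subseteq> {1..n}" "0 < marginal M0 y ?E" "marginal M0 y ?E < \<infinity>"
    "0 < marginal M1 y ?E" "marginal M1 y ?E < \<infinity>"
    using T[OF assms(13)] by (auto simp: minimal_training_samples_def proper_sample_def)
  have SP: "SP_bayes_factor M1 M0 n y ?E =
      bayes_factor M1 M0 y {1..n} * bayes_factor M0 M1 y ?E"
    using M[THEN marginal_wrt_SP_prior, of "{1..n}" y ?E] y E full
    by (simp add: SP_bayes_factor_def bayes_factor_def ennreal_divide_divide_divide)
  have sup: "bayes_factor M0 M1 y ?E = (SUP l\<in>{1..L}. bayes_factor M0 M1 y (T l))"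
    using assms(14) by (simp add: bayes_factor_def)
  have inv: "bayes_factor M1 M0 y I = inverse (bayes_factor M0 M1 y I)"
    if "proper_sample M0 M1 y I" for I
    using that by (simp add: bayes_factor_def proper_sample_def ennreal_inverse_divide)
  \<comment> \<open>The supremum is attained at \<open>l\<^sub>E\<close>, and inversion swaps the
    models and reverses the order, so the infimum is attained at the same index.\<close>
  have inf: "bayes_factor M1 M0 y ?E = (INF l\<in>{1..L}. bayes_factor M1 M0 y (T l))"
  proof (intro antisym INF_greatest INF_lower assms(13))
    fix l assume l: "l \<in> {1..L}"
    then have "bayes_factor M0 M1 y (T l) \<le> bayes_factor M0 M1 y ?E"
      unfolding sup by (rule SUP_upper)
    then show "bayes_factor M1 M0 y ?E \<le> bayes_factor M1 M0 y (T l)"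
      using proper l assms(13) by (simp add: inv ennreal_inverse_antimono)
  qed
  \<comment> \<open>The instance \<open>divide_ennreal_def[of 1]\<close> opens only the outer
    reciprocal and keeps the quotients of marginals intact for the inversion rule.\<close>
  have "1 / SP_bayes_factor M1 M0 n y ?E =
      bayes_factor M0 M1 y {1..n} * bayes_factor M1 M0 y ?E"
    unfolding SP bayes_factor_def using E full
    by (simp add: divide_ennreal_def[of 1] ennreal_inverse_mult_divide)
  with SP show ?thesis
    unfolding empirical_IBF_upper_def empirical_IBF_lower_def sup inf by simp
qed

end
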